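(* Let $\mathbb{K}$ be a field of characteristic zero and let $V$ be a $\mathbb{K}$-vector space with $\dim V=3$. Let $x\in V^\ast$ and $q\in S^2V^\ast$ with $x\neq 0$ and $q\neq 0$. Suppose that \[ x^2q=l_1^4+\cdots+l_7^4 \] in $S^4V^\ast$ for some linear forms $l_1,\ldots,l_7\in V^\ast$ such that the lines $l_1=0,\ldots,l_7=0$ in $\mathbb{P}V$ intersect the line $x=0$ in seven distinct points. Then the line $x=0$ is (possibly improperly) tangent to the conic $q=0$.
   Context: $S^dV^\ast$ denotes the $d$-th symmetric power of the dual space $V^\ast$, i.e. the space of homogeneous polynomial functions of degree $d$ on $V$; products and powers are taken in the symmetric algebra of $V^\ast$. $\mathbb{P}V$ is the set of proportionality classes $[v]$ of nonzero vectors $v\in V$. The field $\mathbb{K}$ is not assumed to be algebraically closed. The hypothesis on intersections means that each $l_i=0$ is a line meeting the line $x=0$ in exactly one point and that these seven points are pairwise distinct. Equivalently, writing $W=\ker x\subseteq V$ (of dimension $2$), the restrictions $l_1|_W,\ldots,l_7|_W\in W^\ast$ are all nonzero and pairwise non-proportional. The line $x=0$ is (possibly improperly) tangent to the conic $q=0$ when there is a nonzero $w\in W=\ker x$ lying in the kernel of the polarization of $Q:=q|_W$, that is, $\overline{Q}(w,u)=0$ for all $u\in W$, where $\overline{Q}$ is the symmetric bilinear form on $W$ with $\overline{Q}(u,u)=Q(u)$. In other words, the binary quadratic form $q|_W$ is degenerate (of rank at most $1$). The words "possibly improperly" mean that degenerate cases are allowed: the conic may be singular, and the line may even be contained in the conic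 ($q|_W=0$). *)

theory Defs
  imports Complex_Main
begin

definition dual_space :: "('k::field \<Rightarrow> 'v::ab_group_add \<Rightarrow> 'v) \<Rightarrow> ('v \<Rightarrow> 'k) set" where
  "dual_space scale = {f. Vector_Spaces.linear scale (*) f}"

(* The elements of S^d V* are homogeneous polynomial functions of degree d, i.e. linear
   combinations of d-fold products of linear forms. They are used below only over fields of
   characteristic zero; these are infinite, so that identities between such functions
   are the same as identities in the symmetric algebra of V*. *)
definition sym_power :: "('k::field \<Rightarrow> 'v::ab_group_add \<Rightarrow> 'v) \<Rightarrow> nat \<Rightarrow> ('v \<Rightarrow> 'k) set" where
  "sym_power scale d =
     {(\<lambda>v. \<Sum>j<n. c j * (\<Prod>i<d. L j i v)) | (n::nat) (c::nat \<Rightarrow> 'k) L.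
        \<forall>j<n. \<forall>i<d. L j i \<in> dual_space scale}"

definition proj_class :: "('k::field \<Rightarrow> 'v::ab_group_add \<Rightarrow> 'v) \<Rightarrow> 'v \<Rightarrow> 'v set" where
  "proj_class scale v = {scale c v | c. c \<noteq> 0}"

definition proj_zeros ::
    "('k::field \<Rightarrow> 'v::ab_group_add \<Rightarrow> 'v) \<Rightarrow> ('v \<Rightarrow> 'k) \<Rightarrow> 'v set set" where
  "proj_zeros scale f = {proj_class scale v | v. v \<noteq> 0 \<and> f v = 0}"

(* B is only constrained on W. Linearity in the second argument follows by symmetry. *)
definition polarization_on ::
    "('k::field \<Rightarrow> 'v::ab_group_add \<Rightarrow> 'v) \<Rightarrow> 'v set \<Rightarrow> ('v \<Rightarrow> 'k) \<Rightarrow> ('v \<Rightarrow> 'v \<Rightarrow> 'k) \<Rightarrow> bool" where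
  "polarization_on scale W Q B \<longleftrightarrow>
     (\<forall>u\<in>W. \<forall>w\<in>W. B u w = B w u) \<and>
     (\<forall>u\<in>W. \<forall>v\<in>W. \<forall>w\<in>W. B (u + v) w = B u w + B v w) \<and>
     (\<forall>c. \<forall>u\<in>W. \<forall>w\<in>W. B (scale c u) w = c * B u w) \<and>
     (\<forall>u\<in>W. B u u = Q u)"

(* In characteristic zero a polarization of a quadratic form on W exists and is unique on W,
   so the existential quantifier over B merely names it. The conic may be singular or
   contain the line. *)
definition line_tangent_to_conic ::
    "('k::field \<Rightarrow> 'v::ab_group_add \<Rightarrow> 'v) \<Rightarrow> ('v \<Rightarrow> 'k) \<Rightarrow> ('v \<Rightarrow> 'k) \<Rightarrow> bool" where
  "line_tangent_to_conic scale x q \<longleftrightarrow>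
     (let W = {v. x v = 0} in
        \<exists>B. polarization_on scale W q B \<and>
            (\<exists>w\<in>W. w \<noteq> 0 \<and> (\<forall>u\<in>W. B w u = 0)))"

end

theory Submission
  imports Defs "HOL-Computational_Algebra.Polynomial"
begin

text \<open>
  Put \<open>W = ker x\<close>, choose \<open>e\<close> with \<open>x e = 1\<close>, and write \<open>a i = l i e\<close>. Comparing powers
  of \<open>t\<close> in the identity at \<open>u + t e\<close> for \<open>u \<in> W\<close> gives \<open>\<Sum> (l i u)^4 = 0\<close>,
  \<open>\<Sum> a i (l i u)^3 = 0\<close> and \<open>q u = 6 \<Sum> (a i)^2 (l i u)^2\<close>. It therefore suffices to find a
  nonzero \<open>w \<in> W\<close> and a quadratic form \<open>g\<close> on the dual of \<open>W\<close> with \<open>a i (l i w) = g (l i)\<close>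
  for all \<open>i\<close>: then \<open>\<Sum> (a i)^2 (l i w) (l i u) = \<Sum> a i g (l i) (l i u)\<close> vanishes by the
  polarized cubic relation.
  Interpolation at three of the forms determines \<open>g\<close> from \<open>w\<close>; a fourth equation is one linear
  condition on \<open>w\<close>, which has a nonzero solution as \<open>W\<close> is not a line. The defects
  \<open>a i (l i w) - g (l i)\<close> are orthogonal to all \<open>(l i u) (l i v)\<close> by the two polarized
  relations, and this forces the remaining three of them to vanish.
\<close>

section \<open>Coefficient comparison and polarization of power sums\<close>

lemma dual_spaceD:
  assumes "f \<in> dual_space scale"
  shows "f (u + v) = f u + f v" and "f (scale c v) = c * f v"
  using assms unfolding dual_space_def
  by (auto simp: Vector_Spaces.linear.axioms module_hom.add module_hom.scale linear_iff_module_hom)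

text \<open>A field of characteristic zero is infinite, so a polynomial that vanishes at every
  \<open>t\<close> is zero.\<close>

lemma quartic_coeffs_eq_0:
  fixes c0 :: "'k::field_char_0"
  assumes "\<And>t. c0 + t * c1 + t^2 * c2 + t^3 * c3 + t^4 * c4 = 0"
  shows "c0 = 0" "c1 = 0" "c2 = 0" "c3 = 0" "c4 = 0"
proof -
  have "poly [:c0, c1, c2, c3, c4:] t = 0" for t
    using assms[of t] by (simp add: algebra_simps power_numeral_reduce)
  then have "[:c0, c1, c2, c3, c4:] = 0"
    using poly_all_0_iff_0 by blast
  then show "c0 = 0" "c1 = 0" "c2 = 0" "c3 = 0" "c4 = 0"
    by auto
qed

lemma sum_quartic_shift:
  fixes a b c :: "'i \<Rightarrow> 'k::comm_ring_1"
  shows "(\<Sum>i\<in>I. a i * (b i + t * c i)^4) =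
    (\<Sum>i\<in>I. a i * b i^4) + t * (4 * (\<Sum>i\<in>I. a i * c i * b i^3)) +
    t^2 * (6 * (\<Sum>i\<in>I. a i * c i^2 * b i^2)) + t^3 * (4 * (\<Sum>i\<in>I. a i * c i^3 * b i)) +
    t^4 * (\<Sum>i\<in>I. a i * c i^4)"
  unfolding sum_distrib_left sum.distrib[symmetric]
  by (rule sum.cong) (simp_all add: algebra_simps power_numeral_reduce)

text \<open>Inclusion-exclusion over the partial sums of \<open>u\<close>, \<open>v\<close>,
  \<open>w\<close> leaves \<open>6\<close> times the mixed term, and \<open>6\<close> is invertible
  in characteristic zero.\<close>

lemma cubic_polarization:
  fixes m :: "'i \<Rightarrow> 'v::ab_semigroup_add \<Rightarrow> 'k::field_char_0"
  assumes add: "\<And>i u v. i \<in> I \<Longrightarrow> m i (u + v) = m i u + m i v"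
    and closed: "\<And>u v. u \<in> W \<Longrightarrow> v \<in> W \<Longrightarrow> u + v \<in> W"
    and zero: "\<And>u. u \<in> W \<Longrightarrow> (\<Sum>i\<in>I. a i * m i u^3) = 0"
    and W: "u \<in> W" "v \<in> W" "w \<in> W"
  shows "(\<Sum>i\<in>I. a i * m i u * m i v * m i w) = 0"
proof -
  let ?S = "\<lambda>u. \<Sum>i\<in>I. a i * m i u^3"
  have "6 * (\<Sum>i\<in>I. a i * m i u * m i v * m i w) =
      ?S (u + v + w) - ?S (u + v) - ?S (u + w) - ?S (v + w) + ?S u + ?S v + ?S w"
    unfolding sum_distrib_left sum.distrib[symmetric] sum_subtractf[symmetric]
    by (rule sum.cong) (simp_all add: add algebra_simps power_numeral_reduce)
  also have "\<dots> = 0"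
    using W by (simp add: zero closed)
  finally show ?thesis by simp
qed

text \<open>The \<open>t\<close>-coefficient of the quartic relation at \<open>u + t s\<close> is a
  cubic relation with weights \<open>m i s\<close>, which reduces the claim to the cubic
  case.\<close>

lemma quartic_polarization:
  fixes m :: "'i \<Rightarrow> 'v::ab_group_add \<Rightarrow> 'k::field_char_0"
  assumes add: "\<And>i u v. i \<in> I \<Longrightarrow> m i (u + v) = m i u + m i v"
    and scale: "\<And>i c u. i \<in> I \<Longrightarrow> m i (scale c u) = c * m i u"
    and closed: "\<And>u v. u \<in> W \<Longrightarrow> v \<in> W \<Longrightarrow> u + v \<in> W"
    and closed_scale: "\<And>c u. u \<in> W \<Longrightarrow> scale c u \<in> W"
    and zero: "\<And>u. u \<in> W \<Longrightarrow> (\<Sum>i\<in>I. m i u^4) = 0"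
    and W: "u \<in> W" "v \<in> W" "w \<in> W" "s \<in> W"
  shows "(\<Sum>i\<in>I. m i s * m i u * m i v * m i w) = 0"
proof (rule cubic_polarization[where W = W])
  fix u assume u: "u \<in> W"
  have "(\<Sum>i\<in>I. 1 * (m i u + t * m i s)^4) = 0" for t
  proof -
    have "(\<Sum>i\<in>I. 1 * (m i u + t * m i s)^4) = (\<Sum>i\<in>I. m i (u + scale t s)^4)"
      by (rule sum.cong) (simp_all add: add scale)
    then show ?thesis
      using u \<open>s \<in> W\<close> by (simp add: zero closed closed_scale)
  qed
  from quartic_coeffs_eq_0(2)[OF this[unfolded sum_quartic_shift]]
  show "(\<Sum>i\<in>I. m i s * m i u^3) = 0" by simp
qed (use add closed W in auto)

section \<open>Restriction of the data to the line \<open>x = 0\<close>\<close>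

lemma sym_power_2_shift:
  assumes "q \<in> sym_power scale 2"
  obtains b where "\<And>t. q (u + scale t e) = q u + t * b + t^2 * q e"
proof -
  obtain n :: nat and c L where q: "q = (\<lambda>v. \<Sum>j<n. c j * (\<Prod>i<2. L j (i::nat) v))"
    and L: "\<forall>j<n. \<forall>i<2. L j i \<in> dual_space scale"
    using assms unfolding sym_power_def by blast
  define b where "b = (\<Sum>j<n. c j * (L j 0 u * L j 1 e + L j 0 e * L j 1 u))"
  have "q (u + scale t e) = q u + t * b + t^2 * q e" for t
    unfolding q b_def sum_distrib_left sum.distrib[symmetric]
  proof (rule sum.cong)
    fix j assume "j \<in> {..<n}"
    then have "L j 0 \<in> dual_space scale" "L j 1 \<in> dual_space scale"
      using L by auto
    then show "c j * (\<Prod>i<2. L j i (u + scale t e)) =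
        c j * (\<Prod>i<2. L j i u) + t * (c j * (L j 0 u * L j 1 e + L j 0 e * L j 1 u)) +
        t^2 * (c j * (\<Prod>i<2. L j i e))"
      by (simp add: numeral_2_eq_2 dual_spaceD algebra_simps)
  qed simp
  then show thesis by (rule that)
qed

text \<open>Since \<open>x (u + t e) = t\<close>, the left-hand side of \<open>eq\<close> at
  \<open>u + t e\<close> is divisible by \<open>t^2\<close> and has \<open>t^2\<close>-coefficient
  \<open>q u\<close>.\<close>

lemma moments_restricted:
  fixes scale :: "'k::field_char_0 \<Rightarrow> 'v::ab_group_add \<Rightarrow> 'v" and l :: "'i \<Rightarrow> 'v \<Rightarrow> 'k"
  assumes x: "x \<in> dual_space scale" and q: "q \<in> sym_power scale 2"
    and l: "\<And>i. i \<in> I \<Longrightarrow> l i \<in> dual_space scale"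
    and eq: "\<And>v. (x v)\<^sup>2 * q v = (\<Sum>i\<in>I. l i v ^ 4)"
    and e: "x e = 1" and u: "x u = 0"
  shows "(\<Sum>i\<in>I. l i u ^ 4) = 0"
    and "(\<Sum>i\<in>I. l i e * l i u ^ 3) = 0"
    and "q u = 6 * (\<Sum>i\<in>I. (l i e)\<^sup>2 * (l i u)\<^sup>2)"
proof -
  obtain b where b: "\<And>t. q (u + scale t e) = q u + t * b + t^2 * q e"
    using sym_power_2_shift[OF q] by blast
  have "(\<Sum>i\<in>I. 1 * l i u^4) + t * (4 * (\<Sum>i\<in>I. 1 * l i e * l i u^3)) +
      t^2 * (6 * (\<Sum>i\<in>I. 1 * (l i e)^2 * (l i u)^2) - q u) +
      t^3 * (4 * (\<Sum>i\<in>I. 1 * l i e^3 * l i u) - b) +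
      t^4 * ((\<Sum>i\<in>I. 1 * l i e^4) - q e) = 0" for t
  proof -
    have "(\<Sum>i\<in>I. 1 * (l i u + t * l i e)^4) = (\<Sum>i\<in>I. l i (u + scale t e)^4)"
      by (rule sum.cong) (simp_all add: dual_spaceD[OF l])
    also have "\<dots> = t^2 * (q u + t * b + t^2 * q e)"
      by (simp add: eq[symmetric] b dual_spaceD[OF x] e u)
    finally show ?thesis
      unfolding sum_quartic_shift by (simp add: algebra_simps power_numeral_reduce)
  qed
  note coeffs = quartic_coeffs_eq_0[OF this]
  show "(\<Sum>i\<in>I. l i u ^ 4) = 0" "(\<Sum>i\<in>I. l i e * l i u ^ 3) = 0"
    "q u = 6 * (\<Sum>i\<in>I. (l i e)\<^sup>2 * (l i u)\<^sup>2)"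
    using coeffs(1-3) by auto
qed

text \<open>The vector \<open>k i\<close> represents the point \<open>p i\<close>; the distinctness
  of the points becomes the nonvanishing of \<open>l i (k j)\<close> for distinct \<open>i\<close>,
  \<open>j\<close>.\<close>

lemma kernel_points:
  assumes vs: "vector_space scale"
    and l: "\<And>i. i \<in> I \<Longrightarrow> l i \<in> dual_space scale"
    and inj: "inj_on p I"
    and p: "\<And>i. i \<in> I \<Longrightarrow> proj_zeros scale (l i) \<inter> proj_zeros scale x = {p i}"
  obtains k where "\<And>i. i \<in> I \<Longrightarrow> k i \<noteq> 0" "\<And>i. i \<in> I \<Longrightarrow> x (k i) = 0"
    "\<And>i j. i \<in> I \<Longrightarrow> j \<in> I \<Longrightarrow> l i (k j) = 0 \<longleftrightarrow> i = j"
proof -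
  interpret vector_space scale by (rule vs)
  have "\<exists>v. v \<noteq> 0 \<and> x v = 0 \<and> p i = proj_class scale v \<and> l i v = 0" if i: "i \<in> I" for i
  proof -
    have "p i \<in> proj_zeros scale (l i)" "p i \<in> proj_zeros scale x"
      using p[OF i] by auto
    then obtain v v' where v: "v \<noteq> 0" "x v = 0" "p i = proj_class scale v"
      and v': "p i = proj_class scale v'" "l i v' = 0"
      unfolding proj_zeros_def by auto
    \<comment> \<open>The representatives \<open>v\<close> and \<open>v'\<close> of
      \<open>p i\<close> are proportional, so \<open>v\<close> is a zero of both \<open>x\<close>
      and \<open>l i\<close>.\<close>
    have "v \<in> proj_class scale v"
      unfolding proj_class_def using scale_one[of v] zero_neq_one
      by (metis (mono_tags, lifting) mem_Collect_eq)
    then obtain c where "v = scale c v'"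
      using v(3) v'(1) unfolding proj_class_def by auto
    then have "l i v = 0"
      using v'(2) dual_spaceD(2)[OF l[OF i]] by simp
    with v show ?thesis by blast
  qed
  then obtain k where k: "\<And>i. i \<in> I \<Longrightarrow> k i \<noteq> 0" "\<And>i. i \<in> I \<Longrightarrow> x (k i) = 0"
    "\<And>i. i \<in> I \<Longrightarrow> p i = proj_class scale (k i)" "\<And>i. i \<in> I \<Longrightarrow> l i (k i) = 0"
    by metis
  have "i = j" if ij: "i \<in> I" "j \<in> I" and "l i (k j) = 0" for i j
  proof -
    have "proj_class scale (k j) \<in> proj_zeros scale (l i) \<inter> proj_zeros scale x"
      unfolding proj_zeros_def using k ij that(3) by blast
    then have "p j = p i"
      using p[OF ij(1)] k(3)[OF ij(2)] by simp
    then show ?thesis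
      using inj ij by (auto dest: inj_onD)
  qed
  then show thesis
    using k that[of k] by blast
qed

section \<open>Construction of the kernel vector\<close>

lemma common_kernel_vector:
  fixes scale :: "'k::field_char_0 \<Rightarrow> 'v::ab_group_add \<Rightarrow> 'v" and l :: "nat \<Rightarrow> 'v \<Rightarrow> 'k"
  assumes vs: "vector_space scale"
    and l: "\<And>i. i \<in> {1..7} \<Longrightarrow> l i \<in> dual_space scale"
    and W_add: "\<And>u v. u \<in> W \<Longrightarrow> v \<in> W \<Longrightarrow> u + v \<in> W"
    and W_scale: "\<And>c u. u \<in> W \<Longrightarrow> scale c u \<in> W"
    and k0: "\<And>i. i \<in> {1..7} \<Longrightarrow> k i \<noteq> 0"
    and kW: "\<And>i. i \<in> {1..7} \<Longrightarrow> k i \<in> W"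
    and k: "\<And>i j. i \<in> {1..7} \<Longrightarrow> j \<in> {1..7} \<Longrightarrow> l i (k j) = 0 \<longleftrightarrow> i = j"
    and quartic: "\<And>u. u \<in> W \<Longrightarrow> (\<Sum>i=1..7. l i u ^ 4) = 0"
    and cubic: "\<And>u. u \<in> W \<Longrightarrow> (\<Sum>i=1..7. a i * l i u ^ 3) = 0"
  obtains w where "w \<in> W" "w \<noteq> 0" "\<And>u. u \<in> W \<Longrightarrow> (\<Sum>i=1..7. (a i)\<^sup>2 * l i w * l i u) = 0"
proof -
  interpret vector_space scale by (rule vs)
  note l_add = dual_spaceD(1)[OF l] and l_scale = dual_spaceD(2)[OF l]
  have T: "(\<Sum>i=1..7. a i * l i u * l i v * l i w) = 0" if "u \<in> W" "v \<in> W" "w \<in> W" for u v w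
    by (rule cubic_polarization[where W = W]) (use that l_add W_add cubic in auto)
  have F: "(\<Sum>i=1..7. l i s * l i u * l i v * l i w) = 0"
    if "u \<in> W" "v \<in> W" "w \<in> W" "s \<in> W" for u v w s
    by (rule quartic_polarization[where W = W and scale = scale])
      (use that l_add l_scale W_add W_scale quartic in auto)

  (* Lagrange interpolation: evaluation at k j is the linear form vanishing at l j. *)
  define A where "A r s t w = a r * l r w / (l r (k s) * l r (k t))" for r s t w
  define g where "g w i = A 1 2 3 w * l i (k 2) * l i (k 3) + A 2 1 3 w * l i (k 1) * l i (k 3)
      + A 3 1 2 w * l i (k 1) * l i (k 2)" for w i
  define h where "h w i = a i * l i w - g w i" for w i
  have A_lin: "A r s t (scale c u + scale d v) = c * A r s t u + d * A r s t v"
    if "r \<in> {1..7}" for r s t c d u v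
    using that by (simp add: A_def l_add l_scale algebra_simps add_divide_distrib)
  have h_lin: "h (scale c u + scale d v) i = c * h u i + d * h v i" if "i \<in> {1..7}" for c d u v i
    using that by (simp add: h_def g_def A_lin l_add l_scale algebra_simps)
  have k_self: "l 1 (k 1) = 0" "l 2 (k 2) = 0" "l 3 (k 3) = 0"
    by (simp_all add: k)
  \<comment> \<open>At each of these indices two terms of \<open>g\<close> vanish, and the
    denominator in \<open>A\<close> cancels the factors of the third.\<close>
  have h123: "h w i = 0" if "i \<in> {1, 2, 3}" for w i
    using that by (auto simp: h_def g_def A_def k k_self simp del: One_nat_def)
  \<comment> \<open>As \<open>h w 4\<close> is linear in \<open>w\<close>, it vanishes at
    \<open>k 1\<close> or at a combination of \<open>k 1\<close> and \<open>k 2\<close>; in the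
    second case \<open>l 1\<close> kills \<open>k 1\<close> but not \<open>k 2\<close>, which shows
    that the combination is nonzero.\<close>
  obtain w where w: "w \<in> W" "w \<noteq> 0" "h w 4 = 0"
  proof (cases "h (k 1) 4 = 0")
    case True
    then show thesis using that[of "k 1"] kW[of 1] k0[of 1] by simp
  next
    case False
    define w where "w = scale (h (k 2) 4) (k 1) + scale (- h (k 1) 4) (k 2)"
    have "h w 4 = 0"
      unfolding w_def by (subst h_lin) auto
    moreover have "l 1 w \<noteq> 0"
      using False by (simp add: w_def l_add l_scale k k_self del: scale_minus_left One_nat_def)
    then have "w \<noteq> 0"
      using l_scale[of 1 0 0] by auto
    moreover have "w \<in> W"
      unfolding w_def by (intro W_add W_scale kW) auto
    ultimately show thesis using that by blast
  qed

  \<comment> \<open>The part \<open>a i * l i w\<close> is handled by \<open>T\<close>. Each term of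
    \<open>g w i\<close> is a product of two evaluations with a constant, so \<open>F\<close>
    applies to it.\<close>
  have orth: "(\<Sum>i=1..7. h w i * l i u * l i v) = 0" if "u \<in> W" "v \<in> W" for u v
  proof -
    have "(\<Sum>i=1..7. h w i * l i u * l i v) = (\<Sum>i=1..7. a i * l i w * l i u * l i v)
       - A 1 2 3 w * (\<Sum>i=1..7. l i (k 2) * l i (k 3) * l i u * l i v)
       - A 2 1 3 w * (\<Sum>i=1..7. l i (k 1) * l i (k 3) * l i u * l i v)
       - A 3 1 2 w * (\<Sum>i=1..7. l i (k 1) * l i (k 2) * l i u * l i v)"
      unfolding sum_distrib_left sum_subtractf[symmetric]
      by (rule sum.cong) (simp_all add: h_def g_def algebra_simps)
    also have "\<dots> = 0"
      using that w kW by (simp add: T F del: One_nat_def)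
    finally show ?thesis .
  qed
  have interval: "{1..7} = {1, 2, 3, 4, 5, 6, 7::nat}"
    by auto
  \<comment> \<open>Testing \<open>orth\<close> on \<open>k r\<close> and \<open>k s\<close> removes
    the indices \<open>r\<close> and \<open>s\<close>; the first four defects are already zero, so
    only \<open>i\<close> remains, with nonzero factors.\<close>
  have h567: "h w i = 0" if irs: "{i, r, s} = {5, 6, 7}" and ne: "i \<noteq> r" "i \<noteq> s" for i r s
  proof -
    have mem: "i \<in> {1..7}" "r \<in> {1..7}" "s \<in> {1..7}"
      using irs unfolding interval by auto
    have "(\<Sum>j=1..7. h w j * l j (k r) * l j (k s)) = (\<Sum>j\<in>{i}. h w j * l j (k r) * l j (k s))"
    proof (rule sum.mono_neutral_right)
      show "\<forall>j\<in>{1..7} - {i}. h w j * l j (k r) * l j (k s) = 0"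
      proof
        fix j :: nat assume "j \<in> {1..7} - {i}"
        then have "j \<in> {1, 2, 3} \<or> j = 4 \<or> j = r \<or> j = s"
          using irs unfolding interval by auto
        then show "h w j * l j (k r) * l j (k s) = 0"
          using h123[of j w] w(3) k[of j j] mem by auto
      qed
    qed (use mem in auto)
    then show ?thesis
      using orth[OF kW kW, of r s] mem ne k[of i r] k[of i s] by simp
  qed
  have "h w i = 0" if "i \<in> {1..7}" for i
    using that h123[of i w] w(3) h567[of 5 6 7] h567[of 6 5 7] h567[of 7 5 6]
    unfolding interval by (auto simp: insert_commute)
  then have ag: "a i * l i w = g w i" if "i \<in> {1..7}" for i
    using that by (simp add: h_def)
  have "(\<Sum>i=1..7. (a i)\<^sup>2 * l i w * l i u) = 0" if u: "u \<in> W" for u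
  proof -
    have "(\<Sum>i=1..7. (a i)\<^sup>2 * l i w * l i u) = (\<Sum>i=1..7. a i * g w i * l i u)"
      by (rule sum.cong) (simp_all add: ag[symmetric] power2_eq_square)
    also have "\<dots> = A 1 2 3 w * (\<Sum>i=1..7. a i * l i (k 2) * l i (k 3) * l i u)
       + A 2 1 3 w * (\<Sum>i=1..7. a i * l i (k 1) * l i (k 3) * l i u)
       + A 3 1 2 w * (\<Sum>i=1..7. a i * l i (k 1) * l i (k 2) * l i u)"
      unfolding sum_distrib_left sum.distrib[symmetric]
      by (rule sum.cong) (simp_all add: g_def algebra_simps)
    also have "\<dots> = 0"
      using u kW by (simp add: T del: One_nat_def)
    finally show ?thesis .
  qed
  with w show thesis using that by blast
qed

theorem mainTheorem1:
  fixes scale :: "'k::field_char_0 \<Rightarrow> 'v::ab_group_add \<Rightarrow> 'v"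
    and x q :: "'v \<Rightarrow> 'k"
    and l :: "nat \<Rightarrow> 'v \<Rightarrow> 'k"
  assumes "vector_space scale"
    and "vector_space.dim scale (UNIV :: 'v set) = 3"
    and "x \<in> dual_space scale" and "x \<noteq> (\<lambda>v. 0)"
    and "q \<in> sym_power scale 2" and "q \<noteq> (\<lambda>v. 0)"
    and "\<forall>i\<in>{1..7}. l i \<in> dual_space scale"
    and "(\<lambda>v. (x v)\<^sup>2 * q v) = (\<lambda>v. \<Sum>i=1..7. (l i v) ^ 4)"
    and "\<exists>p. inj_on p {1..7} \<and>
           (\<forall>i\<in>{1..7}. proj_zeros scale (l i) \<inter> proj_zeros scale x = {p i})"
  shows "line_tangent_to_conic scale x q"
proof -
  let ?W = "{v. x v = 0}"
  note x = dual_spaceD[OF assms(3)]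
  have l: "l i \<in> dual_space scale" if "i \<in> {1..7}" for i
    using assms(7) that by blast
  obtain v where "x v \<noteq> 0"
    using assms(4) by auto
  then have e: "x (scale (inverse (x v)) v) = 1"
    by (simp add: x)
  define a where "a i = l i (scale (inverse (x v)) v)" for i
  have "(x u)\<^sup>2 * q u = (\<Sum>i=1..7. l i u ^ 4)" for u
    using fun_cong[OF assms(8)] .
  note moments = moments_restricted[OF assms(3,5) l this e, folded a_def]
  obtain p where p: "inj_on p {1..7}"
    "\<And>i. i \<in> {1..7} \<Longrightarrow> proj_zeros scale (l i) \<inter> proj_zeros scale x = {p i}"
    using assms(9) by blast
  obtain k where k: "\<And>i. i \<in> {1..7} \<Longrightarrow> k i \<noteq> 0" "\<And>i. i \<in> {1..7} \<Longrightarrow> x (k i) = 0"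
    "\<And>i j. i \<in> {1..7} \<Longrightarrow> j \<in> {1..7} \<Longrightarrow> l i (k j) = 0 \<longleftrightarrow> i = j"
    using kernel_points[OF assms(1) l p] by blast
  obtain w where w: "w \<in> ?W" "w \<noteq> 0"
    "\<And>u. u \<in> ?W \<Longrightarrow> (\<Sum>i=1..7. (a i)\<^sup>2 * l i w * l i u) = 0"
    by (rule common_kernel_vector[OF assms(1) l, where W = ?W and k = k and a = a])
      (use k moments x in auto)
  \<comment> \<open>The factor \<open>6\<close> is the binomial coefficient in the formula for
    \<open>q u\<close> in \<open>moments\<close>.\<close>
  define B where "B u v = 6 * (\<Sum>i=1..7. (a i)\<^sup>2 * l i u * l i v)" for u v
  have "polarization_on scale ?W q B"
    unfolding polarization_on_def
  proof (intro conjI ballI allI)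
    fix u v w :: 'v and c :: 'k
    show "B u w = B w u"
      by (simp add: B_def mult.commute mult.left_commute)
    show "B (u + v) w = B u w + B v w"
      unfolding B_def distrib_left[symmetric] sum.distrib[symmetric]
      by (intro arg_cong[of _ _ "(*) 6"] sum.cong) (simp_all add: dual_spaceD[OF l] algebra_simps)
    show "B (scale c u) w = c * B u w"
      unfolding B_def sum_distrib_left
      by (rule sum.cong) (simp_all add: dual_spaceD[OF l] algebra_simps)
    show "B u u = q u" if "u \<in> ?W"
      using moments(3)[of u] that by (simp add: B_def power2_eq_square mult.assoc)
  qed
  moreover have "B w u = 0" if "u \<in> ?W" for u
    using w(3)[OF that] by (simp add: B_def)
  ultimately show ?thesis
    unfolding line_tangent_to_conic_def Let_def using w(1,2) by blast
qed

end
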